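(* For every smooth function $G=G(y)$ of one variable, the pair $$g=4\,(xG(y)-1)\,dx\,dy,\qquad X=\frac{2G(y)}{xG(y)-1}\,dx,$$ defined where $xG(y)\neq1$, is a Lorentzian generalised Ricci soliton satisfying the projective Einstein–Weyl (pEW) equation $$\nabla_{(a}X_{b)}+X_aX_b+R_{ab}=0 .$$ Furthermore, the metrics of the 3-parameter family given by $G(y)=\tfrac32c^2\sqrt{\tfrac{-6c}{y+d}}+e$ (with real constants $c\neq0,d,e$, where $-6c/(y+d)>0$), and those of the 2-parameter family given by $G(y)=ay+b$ (with real constants $a,b$), admit a Killing symmetry.
   Context: $\nabla$ is the Levi-Civita connection of $g$, $R_{ab}$ its Ricci tensor (in dimension 2, $R_{ab}=Kg_{ab}$ with $K$ the Gauss curvature), and round brackets denote symmetrisation (with factor $\tfrac12$). The pEW equation is the generalised Ricci soliton equation $\nabla_{(a}X_{b)}+c_1X_aX_b-c_2R_{ab}=\lambda g_{ab}$ with $c_1=1$, $c_2=-1$, $\lambda=0$. In $g$, $dx\,dy$ denotes the symmetric product, so $g_{xy}=g_{yx}=2(xG-1)$. *)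

theory Defs
  imports "HOL-Analysis.Analysis"
begin

section \<open>Smooth functions on open sets\<close>

primrec C_k_on :: "nat \<Rightarrow> 'a::euclidean_space set \<Rightarrow> ('a \<Rightarrow> real) \<Rightarrow> bool" where
  "C_k_on 0 S f \<longleftrightarrow> continuous_on S f"
| "C_k_on (Suc k) S f \<longleftrightarrow>
     (\<forall>p\<in>S. f differentiable (at p)) \<and>
     (\<forall>v. C_k_on k S (\<lambda>p. frechet_derivative f (at p) v))"

definition smooth_on :: "'a::euclidean_space set \<Rightarrow> ('a \<Rightarrow> real) \<Rightarrow> bool" where
  "smooth_on S f \<longleftrightarrow> (\<forall>k. C_k_on k S f)"


section \<open>Tensor calculus in a coordinate chart\<close>

text \<open>
  A chart is an open subset of \<^typ>\<open>real ^ 'n\<close>. Metrics, covector fields and vector fields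
  are given by their components: \<open>g p $ a $ b\<close> is $g_{ab}$, \<open>X p $ a\<close> is $X_a$ for a
  one-form and $X^a$ for a vector field. All derivatives are taken at points of an open set, so
  values outside the chart are irrelevant.
\<close>

definition partial :: "'n::finite \<Rightarrow> (real ^ 'n \<Rightarrow> real) \<Rightarrow> real ^ 'n \<Rightarrow> real" where
  "partial a f p = frechet_derivative f (at p) (axis a 1)"

text \<open>
  Signature with one minus sign and all others plus, by Sylvester normal form; the
  congruence also forces symmetry and nondegeneracy of \<open>M\<close>.
\<close>

definition lorentzian_form :: "real ^ 'n ^ 'n \<Rightarrow> bool" where
  "lorentzian_form M \<longleftrightarrow>
     (\<exists>(P :: real ^ 'n ^ 'n) k. invertible P \<and>
        transpose P ** M ** P = (\<chi> i j. if i = j then (if i = k then - 1 else 1) else 0))"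

definition lorentzian_metric_on :: "(real ^ 'n) set \<Rightarrow> (real ^ 'n \<Rightarrow> real ^ 'n ^ 'n) \<Rightarrow> bool" where
  "lorentzian_metric_on U g \<longleftrightarrow>
     open U \<and> (\<forall>a b. smooth_on U (\<lambda>p. g p $ a $ b)) \<and> (\<forall>p\<in>U. lorentzian_form (g p))"

text \<open>\<open>christoffel g c a b p\<close> is $\Gamma^c_{ab}(p)$ for the Levi-Civita connection of \<open>g\<close>.\<close>

definition christoffel ::
    "(real ^ 'n \<Rightarrow> real ^ 'n ^ 'n) \<Rightarrow> 'n \<Rightarrow> 'n \<Rightarrow> 'n \<Rightarrow> real ^ 'n \<Rightarrow> real" where
  "christoffel g c a b p =
     (1 / 2) * (\<Sum>d\<in>UNIV. matrix_inv (g p) $ c $ d *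
        (partial a (\<lambda>q. g q $ d $ b) p + partial b (\<lambda>q. g q $ d $ a) p
          - partial d (\<lambda>q. g q $ a $ b) p))"

definition cov_deriv ::
    "(real ^ 'n \<Rightarrow> real ^ 'n ^ 'n) \<Rightarrow> (real ^ 'n \<Rightarrow> real ^ 'n) \<Rightarrow> 'n \<Rightarrow> 'n \<Rightarrow> real ^ 'n \<Rightarrow> real" where
  "cov_deriv g X a b p =
     partial a (\<lambda>q. X q $ b) p - (\<Sum>c\<in>UNIV. christoffel g c a b p * X p $ c)"

definition sym_cov_deriv ::
    "(real ^ 'n \<Rightarrow> real ^ 'n ^ 'n) \<Rightarrow> (real ^ 'n \<Rightarrow> real ^ 'n) \<Rightarrow> 'n \<Rightarrow> 'n \<Rightarrow> real ^ 'n \<Rightarrow> real" where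
  "sym_cov_deriv g X a b p = (cov_deriv g X a b p + cov_deriv g X b a p) / 2"

text \<open>
  \<open>riemann g c d a b p\<close> is
  $R^c{}_{dab} = \partial_a \Gamma^c_{bd} - \partial_b \Gamma^c_{ad}
     + \Gamma^c_{ae}\Gamma^e_{bd} - \Gamma^c_{be}\Gamma^e_{ad}$, and
  $R_{ab} = R^c{}_{acb}$. With these signs round spheres have positive Ricci tensor, so
  $R_{ab} = K g_{ab}$ in dimension 2.
\<close>

definition riemann ::
    "(real ^ 'n \<Rightarrow> real ^ 'n ^ 'n) \<Rightarrow> 'n \<Rightarrow> 'n \<Rightarrow> 'n \<Rightarrow> 'n \<Rightarrow> real ^ 'n \<Rightarrow> real" where
  "riemann g c d a b p =
     partial a (christoffel g c b d) p - partial b (christoffel g c a d) p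
     + (\<Sum>e\<in>UNIV. christoffel g c a e p * christoffel g e b d p
                   - christoffel g c b e p * christoffel g e a d p)"

definition ricci ::
    "(real ^ 'n \<Rightarrow> real ^ 'n ^ 'n) \<Rightarrow> 'n \<Rightarrow> 'n \<Rightarrow> real ^ 'n \<Rightarrow> real" where
  "ricci g a b p = (\<Sum>c\<in>UNIV. riemann g c a c b p)"

definition generalised_ricci_soliton_on ::
    "real \<Rightarrow> real \<Rightarrow> real \<Rightarrow> (real ^ 'n) set \<Rightarrow> (real ^ 'n \<Rightarrow> real ^ 'n ^ 'n)
      \<Rightarrow> (real ^ 'n \<Rightarrow> real ^ 'n) \<Rightarrow> bool" where
  "generalised_ricci_soliton_on c1 c2 l U g X \<longleftrightarrow>
     (\<forall>a. smooth_on U (\<lambda>p. X p $ a)) \<and>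
     (\<forall>p\<in>U. \<forall>a b. sym_cov_deriv g X a b p + c1 * X p $ a * X p $ b - c2 * ricci g a b p
        = l * g p $ a $ b)"

definition lie_deriv_metric ::
    "(real ^ 'n \<Rightarrow> real ^ 'n) \<Rightarrow> (real ^ 'n \<Rightarrow> real ^ 'n ^ 'n) \<Rightarrow> 'n \<Rightarrow> 'n \<Rightarrow> real ^ 'n \<Rightarrow> real" where
  "lie_deriv_metric V g a b p =
     (\<Sum>c\<in>UNIV. V p $ c * partial c (\<lambda>q. g q $ a $ b) p
        + g p $ c $ b * partial a (\<lambda>q. V q $ c) p
        + g p $ a $ c * partial b (\<lambda>q. V q $ c) p)"

definition killing_field_on ::
    "(real ^ 'n) set \<Rightarrow> (real ^ 'n \<Rightarrow> real ^ 'n ^ 'n) \<Rightarrow> (real ^ 'n \<Rightarrow> real ^ 'n) \<Rightarrow> bool" where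
  "killing_field_on U g V \<longleftrightarrow>
     (\<forall>a. smooth_on U (\<lambda>p. V p $ a)) \<and>
     (\<forall>p\<in>U. \<forall>a b. lie_deriv_metric V g a b p = 0)"

text \<open>
  The chart may be disconnected, so nontriviality of the Killing field is required on each
  connected component.
\<close>

definition admits_killing_symmetry :: "(real ^ 'n) set \<Rightarrow> (real ^ 'n \<Rightarrow> real ^ 'n ^ 'n) \<Rightarrow> bool" where
  "admits_killing_symmetry U g \<longleftrightarrow>
     (\<exists>V. killing_field_on U g V \<and> (\<forall>C\<in>components U. \<exists>p\<in>C. V p \<noteq> 0))"


section \<open>The pair determined by a function of one variable\<close>

text \<open>
  On \<^typ>\<open>real ^ 2\<close> the coordinates are $x$ = \<open>p $ 1\<close> and $y$ = \<open>p $ 2\<close>; \<open>J\<close> is the domain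
  of \<open>G\<close>. Since $dx\,dy$ is the symmetric product, $4 f\,dx\,dy$ has
  $g_{xy} = g_{yx} = 2 f$.
\<close>

definition pew_domain :: "real set \<Rightarrow> (real \<Rightarrow> real) \<Rightarrow> (real ^ 2) set" where
  "pew_domain J G = {p. p $ 2 \<in> J \<and> p $ 1 * G (p $ 2) \<noteq> 1}"

definition pew_metric :: "(real \<Rightarrow> real) \<Rightarrow> real ^ 2 \<Rightarrow> real ^ 2 ^ 2" where
  "pew_metric G p =
     vector [vector [0, 2 * (p $ 1 * G (p $ 2) - 1)],
             vector [2 * (p $ 1 * G (p $ 2) - 1), 0]]"

definition pew_form :: "(real \<Rightarrow> real) \<Rightarrow> real ^ 2 \<Rightarrow> real ^ 2" where
  "pew_form G p = vector [2 * G (p $ 2) / (p $ 1 * G (p $ 2) - 1), 0]"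

end

theory Submission
  imports Defs
begin

text \<open>
  Put $f=xG(y)-1$, so that $g=4f\,dx\,dy$. In such null coordinates the Levi-Civita connection has
  only the symbols $\Gamma^x_{xx}=f_x/f=G/f$ and $\Gamma^y_{yy}=f_y/f$, and
  $R_{xy}=-\partial_x\partial_y\ln\lvert f\rvert=-\partial_y(G/f)=G'/f^2$ while $R_{xx}=R_{yy}=0$.
  Since $X_x=2G/f=2\Gamma^x_{xx}$, the mixed part of the equation reads
  $\tfrac12\partial_yX_x=-R_{xy}$, an identity. The $xx$ part is the Riccati equation
  $\partial_xX_x=-\tfrac12X_x^2$ in $x$, which $2G/(xG-1)$ solves, and the $yy$ part is trivial.
  This is \<open>pew_equation\<close>, resting on \<open>christoffel_pew_metric\<close> and \<open>ricci_pew_metric\<close>.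

  A Killing field preserves the two null directions, hence has the form
  $\alpha(x)\partial_x+\beta(y)\partial_y$, and the only remaining condition is
  $\alpha G+\beta xG'+(xG-1)(\alpha'+\beta')=0$. For $G=ay+b$ it is solved by $\alpha=ax$,
  $\beta=-(ay+b)$, a hyperbolic rotation. For the other family the point is that
  $2(y+d)G'=e-G$ holds, under which $\alpha=1-ex$, $\beta=2(y+d)G$ is a solution
  (\<open>admits_killing_symmetry_ode\<close>). These fields vanish at most on a line $x=t$, whereas the
  components of the domain are open.

  All the differentiability asked for reduces to closure of the smooth functions under sums,
  products, reciprocals, square roots and composition with a coordinate.
\<close>

section \<open>Closure properties of smooth functions\<close>

lemma C_k_on_cong:
  assumes "open S" "\<And>p. p \<in> S \<Longrightarrow> f p = g p" "C_k_on k S f"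
  shows "C_k_on k S g"
  using assms(2,3)
proof (induction k arbitrary: f g)
  case 0
  then show ?case by (simp cong: continuous_on_cong)
next
  case (Suc k)
  have deriv: "(g has_derivative frechet_derivative f (at p)) (at p)" if "p \<in> S" for p
  proof (rule has_derivative_transform_within_open[OF _ assms(1) that])
    show "(f has_derivative frechet_derivative f (at p)) (at p)"
      using Suc.prems(2) that by (simp add: frechet_derivative_works[symmetric])
  qed (simp add: Suc.prems(1))
  have "C_k_on k S (\<lambda>p. frechet_derivative g (at p) v)" for v
  proof (rule Suc.IH[of "\<lambda>p. frechet_derivative f (at p) v"])
    show "frechet_derivative f (at p) v = frechet_derivative g (at p) v" if "p \<in> S" for p
      using frechet_derivative_at[OF deriv[OF that]] by simp
  qed (use Suc.prems(2) in simp)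
  with deriv show ?case by (auto simp: differentiable_def)
qed

lemma C_k_on_SucI:
  assumes "open S"
    and "\<And>p. p \<in> S \<Longrightarrow> (f has_derivative D p) (at p)"
    and "\<And>v. C_k_on k S (\<lambda>p. D p v)"
  shows "C_k_on (Suc k) S f"
proof -
  have "C_k_on k S (\<lambda>p. frechet_derivative f (at p) v)" for v
    by (rule C_k_on_cong[OF assms(1) _ assms(3)[of v]])
      (simp add: frechet_derivative_at[OF assms(2), symmetric])
  with assms(2) show ?thesis by (auto simp: differentiable_def)
qed

lemma C_k_on_Suc_has_derivative:
  assumes "C_k_on (Suc k) S f" "p \<in> S"
  shows "(f has_derivative frechet_derivative f (at p)) (at p)"
  using assms by (simp add: frechet_derivative_works[symmetric])

lemma C_k_on_Suc_imp_C_k_on: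
  assumes "C_k_on (Suc k) S f"
  shows "C_k_on k S f"
  using assms
proof (induction k arbitrary: f)
  case 0
  then show ?case
    by (auto intro!: continuous_at_imp_continuous_on differentiable_imp_continuous_within)
next
  case (Suc k)
  have "C_k_on k S (\<lambda>p. frechet_derivative f (at p) v)" for v
    by (rule Suc.IH) (use Suc.prems in simp)
  moreover have "\<forall>p\<in>S. f differentiable (at p)"
    using Suc.prems by simp
  ultimately show ?case by simp
qed

lemma C_k_on_const: "open S \<Longrightarrow> C_k_on k S (\<lambda>p. c)"
proof (induction k arbitrary: c)
  case (Suc k)
  show ?case
    by (rule C_k_on_SucI[where D = "\<lambda>p v. 0"]) (use Suc in auto)
qed simp

lemma C_k_on_add:
  assumes "open S" "C_k_on k S f" "C_k_on k S g"
  shows "C_k_on k S (\<lambda>p. f p + g p)"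
  using assms(2,3)
proof (induction k arbitrary: f g)
  case 0
  then show ?case by (auto intro: continuous_intros)
next
  case (Suc k)
  show ?case
  proof (rule C_k_on_SucI[OF assms(1)])
    show "((\<lambda>p. f p + g p) has_derivative
        (\<lambda>v. frechet_derivative f (at p) v + frechet_derivative g (at p) v)) (at p)"
      if "p \<in> S" for p
      using that Suc.prems by (intro has_derivative_add C_k_on_Suc_has_derivative)
  qed (use Suc in auto)
qed

lemma C_k_on_mult:
  assumes "open S" "C_k_on k S f" "C_k_on k S g"
  shows "C_k_on k S (\<lambda>p. f p * g p)"
  using assms(2,3)
proof (induction k arbitrary: f g)
  case 0
  then show ?case by (auto intro: continuous_intros)
next
  case (Suc k)
  show ?case
  proof (rule C_k_on_SucI[OF assms(1)])
    show "((\<lambda>p. f p * g p) has_derivative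
        (\<lambda>v. f p * frechet_derivative g (at p) v + frechet_derivative f (at p) v * g p)) (at p)"
      if "p \<in> S" for p
      using that Suc.prems by (intro has_derivative_mult C_k_on_Suc_has_derivative)
    show "C_k_on k S (\<lambda>p. f p * frechet_derivative g (at p) v + frechet_derivative f (at p) v * g p)"
      for v
      using Suc.prems
      by (intro C_k_on_add[OF assms(1)] Suc.IH C_k_on_Suc_imp_C_k_on[of k S f]
            C_k_on_Suc_imp_C_k_on[of k S g]) simp_all
  qed
qed

text \<open>
  The derivative $-(1/f)^2\,df$ is a polynomial in $1/f$ and the derivative of $f$, so the order
  of differentiability climbs by induction.
\<close>

lemma C_k_on_inverse:
  assumes "open S" "C_k_on k S f" "\<And>p. p \<in> S \<Longrightarrow> f p \<noteq> 0"
  shows "C_k_on k S (\<lambda>p. inverse (f p))"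
  using assms(2)
proof (induction k)
  case 0
  then show ?case using assms(3) by (auto intro: continuous_intros)
next
  case (Suc k)
  have IH: "C_k_on k S (\<lambda>p. inverse (f p))"
    by (rule Suc.IH[OF C_k_on_Suc_imp_C_k_on[OF Suc.prems]])
  show ?case
  proof (rule C_k_on_SucI[OF assms(1)])
    show "((\<lambda>p. inverse (f p)) has_derivative
        (\<lambda>v. (- 1) * (inverse (f p) * frechet_derivative f (at p) v * inverse (f p)))) (at p)"
      if "p \<in> S" for p
      using Deriv.has_derivative_inverse[OF assms(3)[OF that] C_k_on_Suc_has_derivative[OF Suc.prems that]]
      by simp
    show "C_k_on k S (\<lambda>p. (- 1) * (inverse (f p) * frechet_derivative f (at p) v * inverse (f p)))"
      for v
      using Suc.prems by (intro C_k_on_mult[OF assms(1)] C_k_on_const[OF assms(1)] IH) simp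
  qed
qed

text \<open>
  Writing the derivative $df/(2\sqrt f)$ as $\tfrac12\,df\cdot f^{-1}\sqrt f$ makes it a product of
  factors already known to be $C^k$.
\<close>

lemma C_k_on_sqrt:
  assumes "open S" "C_k_on k S f" "\<And>p. p \<in> S \<Longrightarrow> f p > 0"
  shows "C_k_on k S (\<lambda>p. sqrt (f p))"
  using assms(2)
proof (induction k)
  case 0
  then show ?case by (simp add: continuous_on_real_sqrt)
next
  case (Suc k)
  have C: "C_k_on k S f"
    using Suc.prems by (rule C_k_on_Suc_imp_C_k_on)
  note IH = Suc.IH[OF C]
  have inv: "C_k_on k S (\<lambda>p. inverse (f p))"
    using assms(3) by (intro C_k_on_inverse[OF assms(1) C]) force
  show ?case
  proof (rule C_k_on_SucI[OF assms(1)])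
    show "((\<lambda>p. sqrt (f p)) has_derivative
        (\<lambda>v. 1 / 2 * (frechet_derivative f (at p) v * (inverse (f p) * sqrt (f p))))) (at p)"
      if "p \<in> S" for p
    proof -
      have pos: "f p > 0" using assms(3) that .
      have "inverse (sqrt (f p)) = inverse (f p) * sqrt (f p)"
        using pos real_sqrt_mult_self[of "f p"]
        by (metis abs_of_pos divide_inverse_commute inverse_eq_divide less_numeral_extra(3)
            nonzero_divide_mult_cancel_right real_sqrt_eq_zero_cancel_iff)
      then have "1 / 2 * (t * (inverse (f p) * sqrt (f p))) = inverse (sqrt (f p)) / 2 * t" for t
        by simp
      moreover have "(sqrt has_real_derivative inverse (sqrt (f p)) / 2) (at (f p))"
        using pos by (rule DERIV_real_sqrt)
      ultimately show ?thesis
        using has_derivative_compose[OF C_k_on_Suc_has_derivative[OF Suc.prems that], of sqrt]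
        by (simp only: has_field_derivative_def)
    qed
    show "C_k_on k S (\<lambda>p. 1 / 2 * (frechet_derivative f (at p) v * (inverse (f p) * sqrt (f p))))"
      for v
    proof -
      have "C_k_on k S (\<lambda>p. frechet_derivative f (at p) v)"
        using Suc.prems by simp
      then show ?thesis
        by (intro C_k_on_mult[OF assms(1)] C_k_on_const[OF assms(1)] IH inv)
    qed
  qed
qed

text \<open>
  By the chain rule the derivative in direction \<open>v\<close> is \<open>L v\<close> times $h'\circ L$, which has the same
  shape with $h'$ in place of \<open>h\<close>.
\<close>

lemma C_k_on_compose_linear:
  fixes L :: "'a::euclidean_space \<Rightarrow> real" and h :: "real \<Rightarrow> real"
  assumes "open S" "bounded_linear L" "L ` S \<subseteq> J" "C_k_on k J h"
  shows "C_k_on k S (\<lambda>p. h (L p))"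
  using assms(4)
proof (induction k arbitrary: h)
  case 0
  have "continuous_on S L"
    using assms(2) by (rule linear_continuous_on)
  then show ?case
    using 0 assms(3) by (auto intro: continuous_on_compose2)
next
  case (Suc k)
  show ?case
  proof (rule C_k_on_SucI[OF assms(1)])
    fix p assume "p \<in> S"
    then have "L p \<in> J" using assms(3) by auto
    then have d: "(h has_derivative frechet_derivative h (at (L p))) (at (L p))"
      by (rule C_k_on_Suc_has_derivative[OF Suc.prems])
    have "frechet_derivative h (at (L p)) = (\<lambda>t. t * frechet_derivative h (at (L p)) 1)"
    proof
      show "frechet_derivative h (at (L p)) t = t * frechet_derivative h (at (L p)) 1" for t
        using linear_scale[OF has_derivative_linear[OF d], of t 1] by simp
    qed
    with d have "(h has_derivative (\<lambda>t. t * frechet_derivative h (at (L p)) 1)) (at (L p))"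
      by (rule subst[rotated])
    from has_derivative_compose[OF bounded_linear_imp_has_derivative[OF assms(2)] this]
    show "((\<lambda>p. h (L p)) has_derivative
        (\<lambda>v. L v * frechet_derivative h (at (L p)) 1)) (at p)" .
  next
    fix v
    show "C_k_on k S (\<lambda>p. L v * frechet_derivative h (at (L p)) 1)"
    proof (rule C_k_on_mult[OF assms(1) C_k_on_const[OF assms(1)]])
      show "C_k_on k S (\<lambda>p. frechet_derivative h (at (L p)) 1)"
        by (rule Suc.IH) (use Suc.prems in simp)
    qed
  qed
qed

lemma C_k_on_ident: "open S \<Longrightarrow> C_k_on k S (\<lambda>t::real. t)"
proof (cases k)
  case (Suc m)
  assume "open S"
  then show ?thesis unfolding Suc
    by (intro C_k_on_SucI[where D = "\<lambda>p v. v"] C_k_on_const) auto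
qed simp

lemma smooth_on_const: "open S \<Longrightarrow> smooth_on S (\<lambda>p. c)"
  by (simp add: smooth_on_def C_k_on_const)

lemma smooth_on_ident: "open S \<Longrightarrow> smooth_on S (\<lambda>t::real. t)"
  by (simp add: smooth_on_def C_k_on_ident)

lemma smooth_on_add:
  "open S \<Longrightarrow> smooth_on S f \<Longrightarrow> smooth_on S g \<Longrightarrow> smooth_on S (\<lambda>p. f p + g p)"
  by (simp add: smooth_on_def C_k_on_add)

lemma smooth_on_mult:
  "open S \<Longrightarrow> smooth_on S f \<Longrightarrow> smooth_on S g \<Longrightarrow> smooth_on S (\<lambda>p. f p * g p)"
  by (simp add: smooth_on_def C_k_on_mult)

lemma smooth_on_diff:
  assumes "open S" "smooth_on S f" "smooth_on S g"
  shows "smooth_on S (\<lambda>p. f p - g p)"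
  using smooth_on_add[OF assms(1,2) smooth_on_mult[OF assms(1) smooth_on_const[OF assms(1), of "- 1"] assms(3)]]
  by simp

lemma smooth_on_divide:
  assumes "open S" "smooth_on S f" "smooth_on S g" "\<And>p. p \<in> S \<Longrightarrow> g p \<noteq> 0"
  shows "smooth_on S (\<lambda>p. f p / g p)"
  using assms by (simp add: smooth_on_def divide_inverse C_k_on_mult C_k_on_inverse)

lemma smooth_on_sqrt:
  "open S \<Longrightarrow> smooth_on S f \<Longrightarrow> (\<And>p. p \<in> S \<Longrightarrow> f p > 0) \<Longrightarrow> smooth_on S (\<lambda>p. sqrt (f p))"
  by (simp add: smooth_on_def C_k_on_sqrt)

lemma smooth_on_compose_nth:
  fixes h :: "real \<Rightarrow> real" and S :: "(real ^ 'n) set"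
  assumes "open S" "\<And>p. p \<in> S \<Longrightarrow> p $ i \<in> J" "smooth_on J h"
  shows "smooth_on S (\<lambda>p. h (p $ i))"
  using assms C_k_on_compose_linear[OF assms(1) bounded_linear_vec_nth[of i], of J _ h]
  by (auto simp: smooth_on_def)

lemma smooth_on_imp_continuous_on: "smooth_on S f \<Longrightarrow> continuous_on S f"
  unfolding smooth_on_def by (metis C_k_on.simps(1))

lemma smooth_on_imp_DERIV:
  fixes f :: "real \<Rightarrow> real"
  assumes "smooth_on S f" "t \<in> S"
  shows "(f has_real_derivative deriv f t) (at t)"
proof -
  have "C_k_on (Suc 0) S f"
    using assms(1) unfolding smooth_on_def by blast
  then have "f differentiable (at t)"
    using assms(2) by simp
  then show ?thesis
    by (metis DERIV_imp_deriv real_differentiable_def)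
qed

lemma smooth_on_deriv:
  fixes f :: "real \<Rightarrow> real"
  assumes "open S" "smooth_on S f"
  shows "smooth_on S (deriv f)"
  unfolding smooth_on_def
proof
  fix k
  have "C_k_on (Suc k) S f"
    using assms(2) unfolding smooth_on_def by blast
  then have "C_k_on k S (\<lambda>p. frechet_derivative f (at p) 1)"
    by simp
  moreover have "frechet_derivative f (at t) 1 = deriv f t" if "t \<in> S" for t
    using frechet_derivative_at[OF smooth_on_imp_DERIV[OF assms(2) that,
        unfolded has_field_derivative_def]] by (metis mult.right_neutral)
  ultimately show "C_k_on k S (deriv f)"
    by (rule C_k_on_cong[OF assms(1), rotated])
qed


section \<open>Geometry of the metric in its null coordinates\<close>

lemma partial_eqI:
  assumes "open U" "p \<in> U" "\<And>q. q \<in> U \<Longrightarrow> f q = h q" "(h has_derivative D) (at p)"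
  shows "partial a f p = D (axis a 1)"
proof -
  have "(f has_derivative D) (at p)"
    by (rule has_derivative_transform_within_open[OF assms(4,1,2)]) (simp add: assms(3))
  then show ?thesis
    unfolding partial_def by (simp add: frechet_derivative_at[symmetric])
qed

lemma partial_const: "partial a (\<lambda>q. c) p = 0"
  by (rule partial_eqI[OF open_UNIV UNIV_I refl has_derivative_const])

lemma has_derivative_compose_nth:
  fixes h :: "real \<Rightarrow> real"
  assumes "(h has_real_derivative h') (at (p $ i))"
  shows "((\<lambda>q. h (q $ i)) has_derivative (\<lambda>v. h' * v $ i)) (at p)"
  using has_derivative_compose[OF bounded_linear_imp_has_derivative[OF bounded_linear_vec_nth]]
    assms unfolding has_field_derivative_def by blast

lemma matrix_inv_eqI:
  fixes A B :: "real ^ 'n ^ 'n"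
  assumes AB: "A ** B = mat 1" and BA: "B ** A = mat 1"
  shows "matrix_inv A = B"
proof -
  have "A ** matrix_inv A = mat 1"
    unfolding matrix_inv_def using someI[of "\<lambda>B. A ** B = mat 1 \<and> B ** A = mat 1" B] assms
    by blast
  then have "B ** (A ** matrix_inv A) = B"
    by simp
  then show ?thesis
    by (simp add: matrix_mul_assoc BA)
qed

lemma matrix_inv_antidiagonal:
  fixes m :: real
  assumes "m \<noteq> 0"
  shows "matrix_inv (vector [vector [0, m], vector [m, 0]] :: real ^ 2 ^ 2)
    = vector [vector [0, 1 / m], vector [1 / m, 0]]"
  by (rule matrix_inv_eqI)
    (use assms in \<open>simp_all add: matrix_matrix_mult_def mat_def vec_eq_iff forall_2 sum_2\<close>)

text \<open>
  The coordinate lines are null, so $\partial_x \mp \partial_y/(2m)$ is an orthonormal frame, the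
  first vector being the timelike one.
\<close>

lemma lorentzian_form_antidiagonal:
  fixes m :: real
  assumes "m \<noteq> 0"
  shows "lorentzian_form (vector [vector [0, m], vector [m, 0]] :: real ^ 2 ^ 2)"
proof -
  define P :: "real ^ 2 ^ 2" where
    "P = vector [vector [1, 1], vector [- 1 / (2 * m), 1 / (2 * m)]]"
  have "det P = 1 / m"
    using assms by (simp add: P_def det_2 field_simps)
  then have "invertible P"
    using assms by (simp add: invertible_det_nz)
  moreover have "transpose P ** vector [vector [0, m], vector [m, 0]] ** P
      = (\<chi> i j. if i = j then (if i = 1 then - 1 else 1) else 0)"
    using assms
    by (simp add: P_def matrix_matrix_mult_def transpose_def vec_eq_iff forall_2 sum_2)
  ultimately show ?thesis
    unfolding lorentzian_form_def by blast
qed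

lemma open_pew_domain:
  assumes "open J" "continuous_on J G"
  shows "open (pew_domain J G)"
proof -
  have J: "open {p :: real ^ 2. p $ 2 \<in> J}"
    using open_vimage[OF assms(1), of "\<lambda>p :: real ^ 2. p $ 2"]
    by (simp add: vimage_def continuous_intros)
  have "continuous_on {p :: real ^ 2. p $ 2 \<in> J} (\<lambda>p. p $ 1 * G (p $ 2))"
    by (intro continuous_intros continuous_on_compose2[OF assms(2)]) auto
  from continuous_open_preimage[OF this J, of "- {1}"] show ?thesis
    by (simp add: pew_domain_def vimage_def Int_def open_Compl)
qed

context
  fixes J :: "real set" and G :: "real \<Rightarrow> real"
  assumes J: "open J" and smooth_G: "smooth_on J G"
begin

abbreviation (input) U where "U \<equiv> pew_domain J G"

lemma open_U: "open U"
  using J smooth_G by (intro open_pew_domain smooth_on_imp_continuous_on)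

lemma factor_nonzero: "p \<in> U \<Longrightarrow> p $ 1 * G (p $ 2) - 1 \<noteq> 0"
  by (simp add: pew_domain_def)

lemma has_derivative_G:
  assumes "p \<in> U"
  shows "((\<lambda>q :: real ^ 2. G (q $ 2)) has_derivative (\<lambda>v. deriv G (p $ 2) * v $ 2)) (at p)"
  using assms smooth_G
  by (intro has_derivative_compose_nth smooth_on_imp_DERIV) (auto simp: pew_domain_def)

lemma smooth_on_factor: "smooth_on U (\<lambda>p. p $ 1 * G (p $ 2) - 1)"
  by (intro smooth_on_diff smooth_on_mult smooth_on_const open_U
      smooth_on_compose_nth[OF open_U _ smooth_on_ident[OF open_UNIV]]
      smooth_on_compose_nth[OF open_U _ smooth_G]) (auto simp: pew_domain_def)

lemma lorentzian_pew_metric: "lorentzian_metric_on U (pew_metric G)"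
proof -
  have "smooth_on U (\<lambda>p. 2 * (p $ 1 * G (p $ 2) - 1))"
    by (intro smooth_on_mult smooth_on_factor smooth_on_const open_U)
  moreover have "lorentzian_form (pew_metric G p)" if "p \<in> U" for p
    unfolding pew_metric_def using factor_nonzero[OF that]
    by (intro lorentzian_form_antidiagonal) simp
  ultimately show ?thesis
    by (simp add: lorentzian_metric_on_def open_U forall_2 pew_metric_def smooth_on_const[OF open_U])
qed

lemma smooth_pew_form: "smooth_on U (\<lambda>p. pew_form G p $ a)"
proof -
  have "smooth_on U (\<lambda>p. 2 * G (p $ 2) / (p $ 1 * G (p $ 2) - 1))"
    by (intro smooth_on_divide smooth_on_mult smooth_on_const smooth_on_factor open_U
      smooth_on_compose_nth[OF open_U _ smooth_G] factor_nonzero) (auto simp: pew_domain_def)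
  moreover have "a = 1 \<or> a = 2"
    by (rule exhaust_2)
  ultimately show ?thesis
    by (auto simp: pew_form_def smooth_on_const[OF open_U])
qed

lemma partial_metric_factor:
  assumes "p \<in> U"
  shows "partial 1 (\<lambda>q. 2 * (q $ 1 * G (q $ 2) - 1)) p = 2 * G (p $ 2)"
    and "partial 2 (\<lambda>q. 2 * (q $ 1 * G (q $ 2) - 1)) p = 2 * (p $ 1 * deriv G (p $ 2))"
proof -
  have "((\<lambda>q. 2 * (q $ 1 * G (q $ 2) - 1)) has_derivative
      (\<lambda>v. 2 * (p $ 1 * (deriv G (p $ 2) * v $ 2) + v $ 1 * G (p $ 2)))) (at p)"
    by (rule derivative_eq_intros has_derivative_G[OF assms] refl
        bounded_linear_imp_has_derivative[OF bounded_linear_vec_nth])+ simp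
  note partial_eqI[OF open_UNIV _ _ this]
  then show "partial 1 (\<lambda>q. 2 * (q $ 1 * G (q $ 2) - 1)) p = 2 * G (p $ 2)"
    and "partial 2 (\<lambda>q. 2 * (q $ 1 * G (q $ 2) - 1)) p = 2 * (p $ 1 * deriv G (p $ 2))"
    by (simp_all add: axis_def)
qed

text \<open>
  For $2F\,dx\,dy$ the only nonzero symbols are the logarithmic derivatives
  $\Gamma^x_{xx}=F_x/F$ and $\Gamma^y_{yy}=F_y/F$.
\<close>

lemma christoffel_pew_metric:
  assumes "p \<in> U"
  shows "christoffel (pew_metric G) c a b p =
    (if a = 1 \<and> b = 1 \<and> c = 1 then G (p $ 2) / (p $ 1 * G (p $ 2) - 1)
     else if a = 2 \<and> b = 2 \<and> c = 2 then p $ 1 * deriv G (p $ 2) / (p $ 1 * G (p $ 2) - 1)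
     else 0)"
proof -
  have inv: "matrix_inv (pew_metric G p) =
      vector [vector [0, 1 / (2 * (p $ 1 * G (p $ 2) - 1))],
              vector [1 / (2 * (p $ 1 * G (p $ 2) - 1)), 0]]"
    unfolding pew_metric_def using factor_nonzero[OF assms]
    by (intro matrix_inv_antidiagonal) simp
  have "\<forall>c a b. christoffel (pew_metric G) c a b p =
    (if a = 1 \<and> b = 1 \<and> c = 1 then G (p $ 2) / (p $ 1 * G (p $ 2) - 1)
     else if a = 2 \<and> b = 2 \<and> c = 2 then p $ 1 * deriv G (p $ 2) / (p $ 1 * G (p $ 2) - 1)
     else 0)"
    unfolding christoffel_def inv forall_2 sum_2
    by (simp add: pew_metric_def partial_const partial_metric_factor[OF assms]
        del: right_diff_distrib_numeral)
  then show ?thesis by blast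
qed

text \<open>
  The potential $G/(xG-1)$ equals both $\Gamma^x_{xx}$ and $\tfrac12 X_x$; its $y$-derivative
  therefore carries the Ricci tensor and the symmetrised derivative of $X$ at the same time.
\<close>

lemma partial_quotient:
  assumes "p \<in> U" and "\<And>q. q \<in> U \<Longrightarrow> f q = k * (G (q $ 2) / (q $ 1 * G (q $ 2) - 1))"
  shows "partial 1 f p = - k * (G (p $ 2))\<^sup>2 / (p $ 1 * G (p $ 2) - 1)\<^sup>2"
    and "partial 2 f p = - k * deriv G (p $ 2) / (p $ 1 * G (p $ 2) - 1)\<^sup>2"
proof -
  note nz = factor_nonzero[OF assms(1)]
  have "((\<lambda>q. k * (G (q $ 2) / (q $ 1 * G (q $ 2) - 1))) has_derivative
      (\<lambda>v. k * ((deriv G (p $ 2) * v $ 2 * (p $ 1 * G (p $ 2) - 1)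
        - G (p $ 2) * (p $ 1 * (deriv G (p $ 2) * v $ 2) + v $ 1 * G (p $ 2)))
        / ((p $ 1 * G (p $ 2) - 1) * (p $ 1 * G (p $ 2) - 1))))) (at p)"
    by (rule derivative_eq_intros has_derivative_divide' has_derivative_G[OF assms(1)] refl nz
        bounded_linear_imp_has_derivative[OF bounded_linear_vec_nth])+ simp
  note D = partial_eqI[OF open_U assms this]
  show "partial 1 f p = - k * (G (p $ 2))\<^sup>2 / (p $ 1 * G (p $ 2) - 1)\<^sup>2"
    using D[of 1] nz by (simp add: axis_def power2_eq_square)
  show "partial 2 f p = - k * deriv G (p $ 2) / (p $ 1 * G (p $ 2) - 1)\<^sup>2"
    using D[of 2] nz by (simp add: axis_def power2_eq_square algebra_simps)
qed

text \<open>
  The component $R_{yx}$ comes out of \<open>ricci\<close> as $-\partial_x\Gamma^y_{yy}$, not as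
  $-\partial_y\Gamma^x_{xx}$; total differentiability of $\Gamma^y_{yy}$ needs a second derivative
  of \<open>G\<close>, which drops out along $x$.
\<close>

lemma partial_christoffel_yy:
  assumes "p \<in> U"
  shows "partial 1 (christoffel (pew_metric G) 2 2 2) p
    = - deriv G (p $ 2) / (p $ 1 * G (p $ 2) - 1)\<^sup>2"
proof -
  note nz = factor_nonzero[OF assms]
  obtain G'' where "(deriv G has_real_derivative G'') (at (p $ 2))"
    using smooth_on_imp_DERIV[OF smooth_on_deriv[OF J smooth_G]] assms
    by (auto simp: pew_domain_def)
  note G'' = has_derivative_compose_nth[OF this]
  have "((\<lambda>q. q $ 1 * deriv G (q $ 2) / (q $ 1 * G (q $ 2) - 1)) has_derivative
      (\<lambda>v. ((p $ 1 * (G'' * v $ 2) + v $ 1 * deriv G (p $ 2)) * (p $ 1 * G (p $ 2) - 1)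
        - p $ 1 * deriv G (p $ 2) * (p $ 1 * (deriv G (p $ 2) * v $ 2) + v $ 1 * G (p $ 2)))
        / ((p $ 1 * G (p $ 2) - 1) * (p $ 1 * G (p $ 2) - 1)))) (at p)"
    by (rule derivative_eq_intros has_derivative_divide' has_derivative_G[OF assms] G'' refl nz
        bounded_linear_imp_has_derivative[OF bounded_linear_vec_nth])+ simp
  from partial_eqI[OF open_U assms _ this, of "christoffel (pew_metric G) 2 2 2" 1]
  show ?thesis
    using nz by (simp add: christoffel_pew_metric axis_def power2_eq_square algebra_simps)
qed

lemma ricci_pew_metric:
  assumes "p \<in> U"
  shows "ricci (pew_metric G) a b p =
    (if a = b then 0 else deriv G (p $ 2) / (p $ 1 * G (p $ 2) - 1)\<^sup>2)"
proof -
  have xx: "partial 2 (christoffel (pew_metric G) 1 1 1) p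
      = - deriv G (p $ 2) / (p $ 1 * G (p $ 2) - 1)\<^sup>2"
    using partial_quotient(2)[OF assms, of "christoffel (pew_metric G) 1 1 1" 1]
    by (simp add: christoffel_pew_metric)
  have mixed: "partial i (christoffel (pew_metric G) c a b) p = 0"
    if "\<not> (a = b \<and> b = c)" for i c a b
    by (rule partial_eqI[OF open_U assms, where h = "\<lambda>q. 0" and D = "\<lambda>v. 0"])
      (use that in \<open>auto simp: christoffel_pew_metric\<close>)
  have "\<forall>a b. ricci (pew_metric G) a b p =
    (if a = b then 0 else deriv G (p $ 2) / (p $ 1 * G (p $ 2) - 1)\<^sup>2)"
    unfolding forall_2
    by (simp add: ricci_def riemann_def sum_2 mixed xx partial_christoffel_yy[OF assms]
        christoffel_pew_metric[OF assms])
  then show ?thesis by blast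
qed

lemma pew_equation:
  assumes "p \<in> U"
  shows "sym_cov_deriv (pew_metric G) (pew_form G) a b p
    + pew_form G p $ a * pew_form G p $ b + ricci (pew_metric G) a b p = 0"
proof -
  note nz = factor_nonzero[OF assms]
  have part: "partial 1 (\<lambda>q. 2 * G (q $ 2) / (q $ 1 * G (q $ 2) - 1)) p
      = - 2 * (G (p $ 2))\<^sup>2 / (p $ 1 * G (p $ 2) - 1)\<^sup>2"
    "partial 2 (\<lambda>q. 2 * G (q $ 2) / (q $ 1 * G (q $ 2) - 1)) p
      = - 2 * deriv G (p $ 2) / (p $ 1 * G (p $ 2) - 1)\<^sup>2"
    by (rule partial_quotient[OF assms, where k = 2], simp)+
  have "\<forall>a b. sym_cov_deriv (pew_metric G) (pew_form G) a b p
    + pew_form G p $ a * pew_form G p $ b + ricci (pew_metric G) a b p = 0"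
    unfolding forall_2 using nz
    by (simp add: sym_cov_deriv_def cov_deriv_def sum_2 christoffel_pew_metric[OF assms]
        ricci_pew_metric[OF assms] pew_form_def partial_const part power2_eq_square)
  then show ?thesis by blast
qed

lemma soliton_pew:
  "generalised_ricci_soliton_on 1 (- 1) 0 U (pew_metric G) (pew_form G)"
  using pew_equation smooth_pew_form by (simp add: generalised_ricci_soliton_on_def)


section \<open>Killing fields\<close>

text \<open>
  For a field $\alpha(x)\partial_x+\beta(y)\partial_y$ the $xx$ and $yy$ components of the Lie
  derivative vanish because the coordinates are null, so the hypothesis \<open>eq\<close> is the $xy$ component
  divided by 2.
\<close>

lemma killing_field_pew_metric:
  assumes "smooth_on UNIV \<alpha>" "smooth_on J \<beta>"
    and eq: "\<And>x y. y \<in> J \<Longrightarrow> \<alpha> x * G y + \<beta> y * (x * deriv G y)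
        + (x * G y - 1) * (deriv \<alpha> x + deriv \<beta> y) = 0"
  shows "killing_field_on U (pew_metric G) (\<lambda>p. vector [\<alpha> (p $ 1), \<beta> (p $ 2)])"
proof -
  have sm: "smooth_on U (\<lambda>p. \<alpha> (p $ 1))" "smooth_on U (\<lambda>p. \<beta> (p $ 2))"
    by (rule smooth_on_compose_nth[OF open_U _ assms(1)], simp)
      (rule smooth_on_compose_nth[OF open_U _ assms(2)], simp add: pew_domain_def)
  have "\<forall>a b. lie_deriv_metric (\<lambda>p. vector [\<alpha> (p $ 1), \<beta> (p $ 2)]) (pew_metric G) a b p = 0"
    if p: "p \<in> U" for p
  proof -
    have y: "p $ 2 \<in> J" using p by (simp add: pew_domain_def)
    have "((\<lambda>q. \<alpha> (q $ 1)) has_derivative (\<lambda>v. deriv \<alpha> (p $ 1) * v $ 1)) (at p)"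
      "((\<lambda>q. \<beta> (q $ 2)) has_derivative (\<lambda>v. deriv \<beta> (p $ 2) * v $ 2)) (at p)"
      using assms(1,2) y by (auto intro!: has_derivative_compose_nth smooth_on_imp_DERIV)
    note this[THEN partial_eqI[OF open_UNIV UNIV_I refl]]
    then show ?thesis
      unfolding forall_2 using eq[OF y, of "p $ 1"]
      by (simp add: lie_deriv_metric_def sum_2 pew_metric_def partial_const
          partial_metric_factor[OF p] axis_def del: right_diff_distrib_numeral)
        (simp add: algebra_simps)
  qed
  with sm show ?thesis
    by (simp add: killing_field_on_def forall_2)
qed

text \<open>
  The field can vanish only on the line $x=t$, which has empty interior and therefore contains no
  component of the open domain.
\<close>

lemma admits_killing_symmetryI:
  assumes "smooth_on UNIV \<alpha>" "smooth_on J \<beta>"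
    and "\<And>x y. y \<in> J \<Longrightarrow> \<alpha> x * G y + \<beta> y * (x * deriv G y)
        + (x * G y - 1) * (deriv \<alpha> x + deriv \<beta> y) = 0"
    and nonzero: "\<And>x y. x \<noteq> t \<Longrightarrow> \<alpha> x \<noteq> 0 \<or> \<beta> y \<noteq> 0"
  shows "admits_killing_symmetry U (pew_metric G)"
  unfolding admits_killing_symmetry_def
proof (intro exI conjI ballI)
  show "killing_field_on U (pew_metric G) (\<lambda>p. vector [\<alpha> (p $ 1), \<beta> (p $ 2)])"
    by (rule killing_field_pew_metric[OF assms(1-3)])
  fix C assume C: "C \<in> components U"
  then have "open C" "C \<noteq> {}"
    using open_components[OF open_U] in_components_nonempty by auto
  moreover have "interior {p :: real ^ 2. p $ 1 = t} = {}"
    by (rule interior_standard_hyperplane)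
  ultimately obtain p where "p \<in> C" "p $ 1 \<noteq> t"
    using interior_maximal[of C "{p :: real ^ 2. p $ 1 = t}"] by auto
  then show "\<exists>p\<in>C. (vector [\<alpha> (p $ 1), \<beta> (p $ 2)] :: real ^ 2) \<noteq> 0"
    using nonzero[of "p $ 1" "p $ 2"] by (intro bexI[of _ p]) (auto simp: vec_eq_iff forall_2)
qed

end

text \<open>
  For $a\neq0$, after translating $y$ by $b/a$, the factor $xG-1$ is invariant under the hyperbolic
  rotations $(x,y)\mapsto(sx,y/s)$, which also preserve $dx\,dy$. Multiplying their generator by
  \<open>a\<close> makes it regular at $a=0$, where it becomes $-b\,\partial_y$. When $b=0$ too, this
  degenerates, but the metric is then constant and every translation is an isometry.
\<close>

lemma admits_killing_symmetry_affine:
  "admits_killing_symmetry (pew_domain UNIV (\<lambda>y. a * y + b)) (pew_metric (\<lambda>y. a * y + b))"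
proof -
  have smooth: "smooth_on UNIV (\<lambda>y::real. m * y + n)" for m n
    by (intro smooth_on_add smooth_on_mult smooth_on_const smooth_on_ident open_UNIV)
  have deriv: "deriv (\<lambda>y::real. m * y + n) t = m" for m n t
    by (rule DERIV_imp_deriv) (auto intro!: derivative_eq_intros)
  show ?thesis
  proof (cases "a = 0 \<and> b = 0")
    case True
    show ?thesis
      by (rule admits_killing_symmetryI[where \<alpha> = "\<lambda>x. 0 * x + 0" and \<beta> = "\<lambda>y. 0 * y + 1"
            and t = 0, OF open_UNIV smooth smooth smooth])
        (use True in \<open>simp_all only: deriv, simp_all\<close>)
  next
    case False
    show ?thesis
      by (rule admits_killing_symmetryI[where \<alpha> = "\<lambda>x. a * x + 0" and \<beta> = "\<lambda>y. (- a) * y + (- b)"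
            and t = 0, OF open_UNIV smooth smooth smooth])
        (use False in \<open>simp_all only: deriv, auto simp: algebra_simps\<close>)
  qed
qed

text \<open>
  Inserting $\alpha=1-ex$ into the Killing equation and comparing powers of $x$ leaves
  $\beta'=G+e$ and $\beta G'=G(e-G)$. Given the differential equation for \<open>G\<close>, both hold for
  $\beta=2(y+d)G$.
\<close>

lemma admits_killing_symmetry_ode:
  fixes G :: "real \<Rightarrow> real"
  assumes "open J" "smooth_on J G" and ode: "\<And>y. y \<in> J \<Longrightarrow> 2 * (y + d) * deriv G y = e - G y"
  shows "admits_killing_symmetry (pew_domain J G) (pew_metric G)"
proof (rule admits_killing_symmetryI[OF assms(1,2),
      where \<alpha> = "\<lambda>x. 1 - e * x" and \<beta> = "\<lambda>y. 2 * (y + d) * G y" and t = "1 / e"])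
  show "smooth_on UNIV (\<lambda>x. 1 - e * x)"
    by (intro smooth_on_diff smooth_on_mult smooth_on_const smooth_on_ident open_UNIV)
  show "smooth_on J (\<lambda>y. 2 * (y + d) * G y)"
    by (intro smooth_on_add smooth_on_mult smooth_on_const smooth_on_ident assms(1,2))
next
  fix x y assume y: "y \<in> J"
  have \<alpha>: "deriv (\<lambda>x. 1 - e * x) x = - e"
    by (rule DERIV_imp_deriv) (auto intro!: derivative_eq_intros)
  have "((\<lambda>y. 2 * (y + d) * G y) has_real_derivative 2 * G y + 2 * (y + d) * deriv G y) (at y)"
    by (auto intro!: derivative_eq_intros smooth_on_imp_DERIV[OF assms(2) y])
  then have \<beta>: "deriv (\<lambda>y. 2 * (y + d) * G y) y = G y + e"
    using ode[OF y] by (simp add: DERIV_imp_deriv)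
  have "2 * (y + d) * G y * (x * deriv G y) = x * G y * (e - G y)"
    using ode[OF y, symmetric] by (simp add: mult_ac)
  then show "(1 - e * x) * G y + 2 * (y + d) * G y * (x * deriv G y)
      + (x * G y - 1) * (deriv (\<lambda>x. 1 - e * x) x + deriv (\<lambda>y. 2 * (y + d) * G y) y) = 0"
    unfolding \<alpha> \<beta> by (simp add: algebra_simps)
next
  fix x y assume "x \<noteq> 1 / e"
  then have "1 - e * x \<noteq> 0"
    by (cases "e = 0") (auto simp: field_simps)
  then show "1 - e * x \<noteq> 0 \<or> 2 * (y + d) * G y \<noteq> 0" ..
qed

text \<open>
  The prefactor is a free constant \<open>k\<close> because a constant plus a multiple of
  $|y+d|^{-1/2}$ solves the differential equation above, whatever the multiple.
\<close>

lemma admits_killing_symmetry_inverse_sqrt: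
  fixes c d e k :: real
  defines "J \<equiv> {y. c / (y + d) > 0}" and "G \<equiv> \<lambda>y. k * sqrt (c / (y + d)) + e"
  shows "admits_killing_symmetry (pew_domain J G) (pew_metric G)"
proof -
  have nz: "y + d \<noteq> 0" if "y \<in> J" for y
    using that by (auto simp: J_def)
  have J: "open J"
  proof -
    have "J = {y. 0 < c * (y + d)}"
      by (auto simp: J_def zero_less_divide_iff zero_less_mult_iff)
    then show ?thesis by (simp add: open_Collect_less continuous_intros)
  qed
  have G: "smooth_on J G"
    unfolding G_def
    by (intro smooth_on_add smooth_on_mult smooth_on_sqrt smooth_on_divide smooth_on_const
        smooth_on_ident J nz) (simp_all add: J_def)
  show ?thesis
  proof (rule admits_killing_symmetry_ode[OF J G])
    fix y assume y: "y \<in> J"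
    define s where "s = sqrt (c / (y + d))"
    have pos: "c / (y + d) > 0"
      using y by (simp add: J_def)
    then have "s > 0"
      by (simp add: s_def)
    have "s * s = c / (y + d)"
      unfolding s_def using pos by (simp only: real_sqrt_mult_self abs_of_pos)
    then have c: "c = s * s * (y + d)"
      using nz[OF y] by (simp add: field_simps)
    have "((\<lambda>y. c / (y + d)) has_real_derivative - c / ((y + d) * (y + d))) (at y)"
      using nz[OF y] by (auto intro!: derivative_eq_intros)
    from DERIV_chain2[OF DERIV_real_sqrt[OF pos] this]
    have "(G has_real_derivative
        k * (inverse (sqrt (c / (y + d))) / 2 * (- c / ((y + d) * (y + d)))) + 0) (at y)"
      unfolding G_def by (intro DERIV_add DERIV_cmult DERIV_const)
    then have "(G has_real_derivative k * (inverse s / 2 * (- c / ((y + d) * (y + d))))) (at y)"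
      by (simp only: s_def add_0_right)
    moreover have "inverse s / 2 * (- c / ((y + d) * (y + d))) = - s / (2 * (y + d))"
      unfolding c using \<open>s > 0\<close> nz[OF y] by (simp add: divide_simps)
    ultimately have "deriv G y = k * (- s / (2 * (y + d)))"
      by (simp only: DERIV_imp_deriv)
    then have "2 * (y + d) * deriv G y = - (k * s)"
      using nz[OF y] by (simp add: field_simps)
    then show "2 * (y + d) * deriv G y = e - G y"
      by (simp add: G_def s_def)
  qed
qed


section \<open>The soliton and its symmetric families\<close>

theorem proposition8p4:
  shows
    "(\<forall>(J :: real set) (G :: real \<Rightarrow> real). open J \<longrightarrow> smooth_on J G \<longrightarrow>
        lorentzian_metric_on (pew_domain J G) (pew_metric G) \<and>
        generalised_ricci_soliton_on 1 (- 1) 0 (pew_domain J G) (pew_metric G) (pew_form G) \<and>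
        (\<forall>p\<in>pew_domain J G. \<forall>a b.
           sym_cov_deriv (pew_metric G) (pew_form G) a b p
             + pew_form G p $ a * pew_form G p $ b + ricci (pew_metric G) a b p = 0)) \<and>
     (\<forall>c d e :: real. c \<noteq> 0 \<longrightarrow>
        (let J = {y. - 6 * c / (y + d) > 0};
             G = (\<lambda>y. 3 / 2 * c ^ 2 * sqrt (- 6 * c / (y + d)) + e)
         in admits_killing_symmetry (pew_domain J G) (pew_metric G))) \<and>
     (\<forall>a b :: real.
        (let G = (\<lambda>y. a * y + b)
         in admits_killing_symmetry (pew_domain UNIV G) (pew_metric G)))"
proof (intro conjI allI impI)
  fix c d e :: real
  show "let J = {y. - 6 * c / (y + d) > 0};
            G = (\<lambda>y. 3 / 2 * c ^ 2 * sqrt (- 6 * c / (y + d)) + e)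
        in admits_killing_symmetry (pew_domain J G) (pew_metric G)"
    unfolding Let_def by (rule admits_killing_symmetry_inverse_sqrt)
next
  fix a b :: real
  show "let G = (\<lambda>y. a * y + b)
        in admits_killing_symmetry (pew_domain UNIV G) (pew_metric G)"
    unfolding Let_def by (rule admits_killing_symmetry_affine)
qed (rule lorentzian_pew_metric soliton_pew pew_equation | intro ballI allI | assumption)+

end
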